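(* Let $\alpha\in\,]0,1[$, let $\bar w\sim\mathcal{N}(0,\bar\Sigma)$ with $\bar\Sigma>0$, and let $\eta(\bar x_\theta,\bar u_\theta)=T^x\bar x_\theta+T^u\bar u_\theta-y$ with $T^x\in\mathbb{R}^{r\times(N+1)n}$, $T^u\in\mathbb{R}^{r\times Nm}$, $y\in\mathbb{R}^r$. Let $\beta(\alpha)=\sqrt{F^{-1}(1-\alpha)}$, where $F$ is the probability distribution function of a $\chi^2$ random variable with $r$ degrees of freedom. For every $\theta\in\Theta$ such that $\bar\Sigma_\theta=P_\theta\bar\Sigma P_\theta^T$ is invertible, the constraint $\mathbb{P}[\eta(\bar x_\theta,\bar u_\theta)\le 0]\ge 1-\alpha$ is conservatively approximated (i.e. implied) by the constraint $$\mathcal{E}\big(h_\theta,\bar\Sigma_\theta,\beta(\alpha)\big)\subset(-\infty,0]^r. \qquad ( * )$$ Moreover, $( * )$ is equivalent to the set of second-order cone constraints $$h_{i,\theta}+\beta(\alpha)\,\|\bar\Sigma^{1/2}P_{i,\theta}\|\le 0,\quad i=1,\dots,r. \qquad ( ** )$$ As a consequence, if $\bar\Sigma_\theta$ is invertible for all $\theta\in\Theta$, $V:\mathbb{R}^{(N+1)n}\times\mathbb{R}^{Nm}\to\mathbb{R}$ is measurable and convex, and $\mathbb{E}[V(\bar x_\theta,\bar u_\theta)]$ is finite for all $\theta\in\Theta$, then the problem $$\inf_{\theta\in\Theta}\ \mathbb{E}[V(\bar x_\theta,\bar u_\theta)]\quad\text{subject to } ( ** )$$ is a convex conservative approximation of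 the problem $$\inf_{\theta\in\Theta}\ \mathbb{E}[V(\bar x_\theta,\bar u_\theta)]\quad\text{subject to}\quad\mathbb{P}(\eta(\bar x_\theta,\bar u_\theta)\le 0)\ge 1-\alpha.$$
   Context: Let $n,m,N,r\ge 1$ be integers, $A\in\mathbb{R}^{n\times n}$, $B\in\mathbb{R}^{n\times m}$, $x_0\in\mathbb{R}^n$, and let $w(0),\dots,w(N-1)$ be $\mathbb{R}^n$-valued random vectors on a probability space $(\Omega,\mathfrak{F},\mathbb{P})$, stacked into $\bar w\in\mathbb{R}^{Nn}$. The linear system $x(t+1)=Ax(t)+Bu(t)+w(t)$, $x(0)=x_0$, is written over $t=0,\dots,N$ as $\bar x=\bar A x_0+\bar B\bar u+\bar D\bar w$, where $\bar x\in\mathbb{R}^{(N+1)n}$ stacks $x(0),\dots,x(N)$ and $\bar u\in\mathbb{R}^{Nm}$ stacks $u(0),\dots,u(N-1)$; $\bar A$ stacks $I_n,A,\dots,A^N$; $\bar B$ is the $(N+1)n\times Nm$ matrix whose $n\times m$ block in position $(t,s)$, $0\le t\le N$, $0\le s\le N-1$, is $A^{t-1-s}B$ if $s<t$ and $0$ otherwise; $\bar D$ is the $(N+1)n\times Nn$ matrix whose $n\times n$ block $(t,s)$ is $A^{t-1-s}$ if $s<t$ and $0$ otherwise. $\Theta$ is the linear space of parameters $\theta=(\bar G,\bar d)$ with $\bar d\in\mathbb{R}^{Nm}$ and $\bar G\in\mathbb{R}^{Nm\times Nn}$ strictly block lower triangular (its $m\times n$ block $(t,i)$, $0\le t,i\le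 N-1$, vanishes whenever $i\ge t$). For $\theta\in\Theta$, $\bar u_\theta=\bar G\bar w+\bar d$ and $\bar x_\theta=\bar A x_0+\bar B(\bar G\bar w+\bar d)+\bar D\bar w$. Set $h_\theta=(T^x\bar A x_0-y)+(T^x\bar B+T^u)\bar d\in\mathbb{R}^r$ and $P_\theta=T^x\bar D+(T^x\bar B+T^u)\bar G\in\mathbb{R}^{r\times Nn}$, so that $\eta(\bar x_\theta,\bar u_\theta)=h_\theta+P_\theta\bar w$; $h_{i,\theta}$ is the $i$-th entry of $h_\theta$ and $P_{i,\theta}^T$ the $i$-th row of $P_\theta$. For $\beta>0$ and $\bar\Sigma_\theta$ invertible, $\mathcal{E}(h_\theta,\bar\Sigma_\theta,\beta)=\{\eta\in\mathbb{R}^r:\ (\eta-h_\theta)^T\bar\Sigma_\theta^{-1}(\eta-h_\theta)\le\beta^2\}$. $\bar\Sigma^{1/2}$ is a symmetric real square root of $\bar\Sigma$, $\|\cdot\|$ is the Euclidean norm, vector inequalities are componentwise. A problem is a convex conservative approximation of another problem with the same objective if its objective is convex, its feasible set is convex, and every $\theta$ feasible for it is feasible for the other problem. *)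

theory Defs
  imports "HOL-Probability.Probability"
begin

section \<open>Time indices and stacked vectors\<close>

text \<open>
  The horizon $N$ is the cardinality of an arbitrary finite linearly ordered type \<open>'t\<close>, whose
  elements stand for the times $0,\dots,N-1$ (\<open>time\<close> gives the numerical value). The $N+1$ state
  times $0,\dots,N$ are the elements of \<open>'t option\<close>, with \<open>None\<close> the terminal time $N$. A stacked
  vector with blocks in $\mathbb{R}^n$ is indexed by pairs (time, component), and a block matrix by
  two such pairs.
\<close>

definition time :: "'t::{finite,linorder} \<Rightarrow> nat" where
  "time t = card {s. s < t}"

definition state_time :: "'t::{finite,linorder} option \<Rightarrow> nat" where
  "state_time t = (case t of Some s \<Rightarrow> time s | None \<Rightarrow> CARD('t))"

lemma time_less_iff: "time s < time t \<longleftrightarrow> s < t"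
proof -
  have *: "time s < time t" if "s < t" for s t :: 'a
    unfolding time_def using that by (intro psubset_card_mono) auto
  show ?thesis
    by (metis * linorder_neqE order_less_asym order_less_irrefl)
qed

lemma bij_betw_time: "bij_betw (time :: 't::{finite,linorder} \<Rightarrow> nat) UNIV {..<CARD('t)}"
proof -
  have inj: "inj (time :: 't \<Rightarrow> nat)"
    by (rule injI) (metis linorder_neqE order_less_irrefl time_less_iff)
  have "time t < CARD('t)" for t :: 't
    unfolding time_def by (intro psubset_card_mono) auto
  then have "range (time :: 't \<Rightarrow> nat) \<subseteq> {..<CARD('t)}" by auto
  then have "range (time :: 't \<Rightarrow> nat) = {..<CARD('t)}"
    by (intro card_subset_eq) (simp_all add: card_image[OF inj])
  with inj show ?thesis by (simp add: bij_betw_def)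
qed

lemma bij_betw_state_time:
  "bij_betw (state_time :: 't::{finite,linorder} option \<Rightarrow> nat) UNIV {..CARD('t)}"
proof -
  have "bij_betw (state_time :: 't option \<Rightarrow> nat) (Some ` UNIV) {..<CARD('t)}"
    using bij_betw_time[where 't='t]
    by (auto simp: bij_betw_def inj_on_def state_time_def image_image)
  then have "bij_betw (state_time :: 't option \<Rightarrow> nat) (Some ` UNIV \<union> {None}) ({..<CARD('t)} \<union> {CARD('t)})"
    by (rule bij_betw_combine) (auto simp: state_time_def bij_betw_def)
  moreover have "Some ` UNIV \<union> {None} = (UNIV :: 't option set)"
    by (auto simp: UNIV_option_conv)
  moreover have "{..<CARD('t)} \<union> {CARD('t)} = {..CARD('t)}" by auto
  ultimately show ?thesis by simp
qed

definition stack :: "(nat \<Rightarrow> real^'n) \<Rightarrow> real^('t::{finite,linorder} \<times> 'n)" where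
  "stack w = (\<chi> p. w (time (fst p)) $ snd p)"


section \<open>The stacked linear system\<close>

text \<open>The operator \<open>^\<close> on square matrices of type \<open>real^'n^'n\<close> is the entrywise power.\<close>

primrec matpow :: "real^'n^'n \<Rightarrow> nat \<Rightarrow> real^'n^'n" where
  "matpow A 0 = mat 1"
| "matpow A (Suc k) = A ** matpow A k"

definition Abar :: "real^'n^'n \<Rightarrow> real^'n^('t::{finite,linorder} option \<times> 'n)" where
  "Abar A = (\<chi> p j. matpow A (state_time (fst p)) $ snd p $ j)"

definition Bbar :: "real^'n^'n \<Rightarrow> real^'m^'n \<Rightarrow> real^('t \<times> 'm)^('t::{finite,linorder} option \<times> 'n)" where
  "Bbar A B = (\<chi> p q. if time (fst q) < state_time (fst p)
      then (matpow A (state_time (fst p) - 1 - time (fst q)) ** B) $ snd p $ snd q else 0)"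

definition Dbar :: "real^'n^'n \<Rightarrow> real^('t \<times> 'n)^('t::{finite,linorder} option \<times> 'n)" where
  "Dbar A = (\<chi> p q. if time (fst q) < state_time (fst p)
      then matpow A (state_time (fst p) - 1 - time (fst q)) $ snd p $ snd q else 0)"

type_synonym ('t, 'n, 'm) policy = "(real^('t \<times> 'n)^('t \<times> 'm)) \<times> (real^('t \<times> 'm))"

definition policies :: "('t::{finite,linorder}, 'n::finite, 'm::finite) policy set" where
  "policies = {(G, d). \<forall>t i a b. i \<ge> t \<longrightarrow> G $ (t, a) $ (i, b) = 0}"

definition ubar :: "('t::{finite,linorder}, 'n::finite, 'm::finite) policy \<Rightarrow> real^('t \<times> 'n) \<Rightarrow> real^('t \<times> 'm)" where
  "ubar \<theta> wb = fst \<theta> *v wb + snd \<theta>"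

definition xbar :: "real^'n^'n \<Rightarrow> real^'m^'n \<Rightarrow> real^'n \<Rightarrow> ('t::{finite,linorder}, 'n, 'm) policy
    \<Rightarrow> real^('t \<times> 'n) \<Rightarrow> real^('t option \<times> 'n)" where
  "xbar A B x0 \<theta> wb = Abar A *v x0 + Bbar A B *v ubar \<theta> wb + Dbar A *v wb"


section \<open>The constraint function\<close>

definition eta :: "real^'sx^'r \<Rightarrow> real^'su^'r \<Rightarrow> real^'r \<Rightarrow> real^'sx \<Rightarrow> real^'su \<Rightarrow> real^'r" where
  "eta Tx Tu y x u = Tx *v x + Tu *v u - y"

definition h_vec :: "real^'n^'n \<Rightarrow> real^'m^'n \<Rightarrow> real^'n
    \<Rightarrow> real^('t option \<times> 'n)^'r \<Rightarrow> real^('t \<times> 'm)^'r \<Rightarrow> real^'r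
    \<Rightarrow> ('t::{finite,linorder}, 'n, 'm) policy \<Rightarrow> real^'r" where
  "h_vec A B x0 Tx Tu y \<theta> = ((Tx ** Abar A) *v x0 - y) + (Tx ** Bbar A B + Tu) *v snd \<theta>"

definition P_mat :: "real^'n^'n \<Rightarrow> real^'m^'n
    \<Rightarrow> real^('t option \<times> 'n)^'r \<Rightarrow> real^('t \<times> 'm)^'r
    \<Rightarrow> ('t::{finite,linorder}, 'n, 'm) policy \<Rightarrow> real^('t \<times> 'n)^'r" where
  "P_mat A B Tx Tu \<theta> = Tx ** Dbar A + (Tx ** Bbar A B + Tu) ** fst \<theta>"

definition ellipsoid :: "real^'r \<Rightarrow> real^'r^'r \<Rightarrow> real \<Rightarrow> (real^'r) set" where
  "ellipsoid h S \<beta> = {e. (e - h) \<bullet> (matrix_inv S *v (e - h)) \<le> \<beta>\<^sup>2}"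


section \<open>Gaussian vectors and the chi-squared distribution\<close>

definition pos_def :: "real^'d^'d \<Rightarrow> bool" where
  "pos_def S \<longleftrightarrow> transpose S = S \<and> (\<forall>v. v \<noteq> 0 \<longrightarrow> v \<bullet> (S *v v) > 0)"

definition sym_sqrt_of :: "real^'d^'d \<Rightarrow> real^'d^'d \<Rightarrow> bool" where
  "sym_sqrt_of R S \<longleftrightarrow> transpose R = R \<and> R ** R = S"

definition mvnormal_density :: "real^'d \<Rightarrow> real^'d^'d \<Rightarrow> real^'d \<Rightarrow> real" where
  "mvnormal_density \<mu> S x =
     exp (- ((x - \<mu>) \<bullet> (matrix_inv S *v (x - \<mu>))) / 2) / sqrt ((2 * pi) ^ CARD('d) * det S)"

definition chi_squared :: "nat \<Rightarrow> real measure" where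
  "chi_squared k = distr (PiM {..<k} (\<lambda>_. density lborel std_normal_density)) borel
     (\<lambda>z. \<Sum>i<k. (z i)\<^sup>2)"

text \<open>
  The distribution function of \<open>chi_squared k\<close> (for $k \ge 1$) is $0$ on the negative reals and
  maps $[0,\infty)$ bijectively to $[0,1)$, and it is this restriction that is inverted.
\<close>

definition beta :: "nat \<Rightarrow> real \<Rightarrow> real" where
  "beta r \<alpha> = sqrt (the_inv_into {0..} (cdf (chi_squared r)) (1 - \<alpha>))"


section \<open>Optimization problems\<close>

record 'p opt_problem =
  param_space :: "'p set"
  objective :: "'p \<Rightarrow> real"
  constraint :: "'p \<Rightarrow> bool"

definition feasible :: "'p opt_problem \<Rightarrow> 'p set" where
  "feasible Q = {\<theta> \<in> param_space Q. constraint Q \<theta>}"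

definition convex_conservative_approx :: "'p::real_vector opt_problem \<Rightarrow> 'p opt_problem \<Rightarrow> bool" where
  "convex_conservative_approx Q R \<longleftrightarrow>
     param_space Q = param_space R \<and> objective Q = objective R \<and>
     convex_on (param_space Q) (objective Q) \<and> convex (feasible Q) \<and> feasible Q \<subseteq> feasible R"

end

theory Submission
  imports Defs
begin

text \<open>
  The constraint function is \<open>h + P *v w\<close> with \<open>w\<close> a centred Gaussian vector of covariance
  \<open>\<Sigma>\<close>, so it is Gaussian with mean \<open>h\<close> and covariance \<open>K = P ** \<Sigma> ** transpose P\<close>.

  Why the ellipsoid constraint suffices: for invertible \<open>K\<close>, the quadratic form of
  \<open>matrix_inv K\<close> at the fluctuation \<open>P *v w\<close> is chi-squared distributed with as many degrees of
  freedom as there are constraints, so the ellipsoid with radius the square root of the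
  \<open>1 - \<alpha>\<close> quantile carries probability exactly \<open>1 - \<alpha>\<close> (\<open>prob_gaussian_in_ellipsoid\<close>). If the
  ellipsoid lies in the nonpositive orthant, the orthant has at least that probability. The
  chi-squared law is obtained by whitening. Gram-Schmidt for the inner product defined by \<open>\<Sigma>\<close>
  gives a square matrix \<open>T\<close> with \<open>T ** \<Sigma> ** transpose T = mat 1\<close> such that the quadratic form
  is the sum of squares of some coordinates of \<open>T *v w\<close> (\<open>whitening_extension\<close>), and \<open>T *v w\<close>
  is a standard Gaussian vector (\<open>distr_whitened_gaussian\<close>). That the quantile is attained comes
  from \<open>cdf_chi_squared_inj_range\<close>.

  Why the ellipsoid constraint is a set of cone constraints: the support function of the ellipsoid
  in the \<open>i\<close>-th coordinate direction is given by Cauchy-Schwarz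
  (\<open>ellipsoid_subset_orthant_iff\<close>).

  Why the resulting problem is convex: \<open>h\<close>, \<open>P\<close>, the state, and the input are affine in the
  policy, so the cone constraints define a convex set (\<open>convex_soc\<close>) and the expectation of a
  convex cost is convex (\<open>convex_expected_cost\<close>).
\<close>

section \<open>Whitening a positive definite matrix\<close>

lemma matrix_vector_mul_row: "(A *v x) $ i = row i A \<bullet> x" for A :: "real^'n^'m"
  by (simp add: matrix_vector_mul_component row_def vec_lambda_eta)

lemma transpose_mul_axis: "transpose A *v axis i 1 = row i A" for A :: "real^'n^'m"
  by (simp add: matrix_vector_mult_basis row_def column_def transpose_def)

lemma inner_mul_eq: "x \<bullet> (A *v y) = (transpose A *v x) \<bullet> y" for A :: "real^'n^'m"
  by (metis dot_lmul_matrix vector_transpose_matrix transpose_transpose)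

lemma quadratic_form_congruence:
  "x \<bullet> ((A ** S ** transpose A) *v y) = (transpose A *v x) \<bullet> (S *v (transpose A *v y))"
  for A :: "real^'n^'m" and S :: "real^'n^'n"
  by (simp add: inner_mul_eq[of x A] flip: matrix_vector_mul_assoc)

lemma congruence_component:
  "(A ** S ** transpose A) $ i $ j = row i A \<bullet> (S *v row j A)"
  for A :: "real^'n^'m" and S :: "real^'n^'n"
proof -
  have "(A ** S ** transpose A) $ i $ j = axis i 1 \<bullet> ((A ** S ** transpose A) *v axis j 1)"
    by (simp add: matrix_vector_mult_basis column_def inner_axis')
  then show ?thesis by (simp only: quadratic_form_congruence transpose_mul_axis)
qed

lemma matrix_inv_eqI: "matrix_inv A = B" if "B ** A = mat 1" for A B :: "real^'n^'n"
proof -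
  have AB: "A ** B = mat 1" using that matrix_left_right_inverse by blast
  have "A ** matrix_inv A = mat 1 \<and> matrix_inv A ** A = mat 1"
    unfolding matrix_inv_def by (rule someI[of _ B]) (simp add: that AB)
  then show ?thesis by (metis AB matrix_mul_assoc matrix_mul_lid matrix_mul_rid)
qed

text \<open>
  In the coordinates \<open>T *v v\<close> the quadratic form of \<open>matrix_inv S\<close> becomes the squared Euclidean
  norm.
\<close>
lemma matrix_inv_whitened:
  fixes S T :: "real^'d^'d"
  assumes "T ** S ** transpose T = mat 1"
  shows "matrix_inv S = transpose T ** T"
proof (rule matrix_inv_eqI)
  have "transpose T ** (T ** S) = mat 1" using assms matrix_left_right_inverse by blast
  then show "transpose T ** T ** S = mat 1" by (simp add: matrix_mul_assoc)
qed

text \<open>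
  Orthonormality for the inner product \<open>a \<bullet> (S *v b)\<close>. The rows of a whitening matrix of \<open>S\<close>
  are exactly an orthonormal basis in this sense.
\<close>
definition orthonormal_wrt :: "real^'d^'d \<Rightarrow> (real^'d) set \<Rightarrow> bool" where
  "orthonormal_wrt S B \<longleftrightarrow> (\<forall>a\<in>B. \<forall>b\<in>B. a \<bullet> (S *v b) = (if a = b then 1 else 0))"

text \<open>
  Gram-Schmidt orthogonalisation for the inner product given by \<open>S\<close>, started from a family that
  is already orthonormal and is kept.
\<close>
lemma gram_schmidt_wrt:
  fixes S :: "real^'d^'d"
  assumes S: "pos_def S" and B: "finite B" "orthonormal_wrt S B" and F: "finite F"
  shows "\<exists>C. finite C \<and> B \<subseteq> C \<and> orthonormal_wrt S C \<and> F \<subseteq> span C"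
  using F
proof (induction F)
  case empty
  show ?case using B by blast
next
  case (insert a F)
  then obtain C where C: "finite C" "B \<subseteq> C" "orthonormal_wrt S C" "F \<subseteq> span C" by blast
  have sym: "x \<bullet> (S *v y) = y \<bullet> (S *v x)" for x y
    using S unfolding pos_def_def by (metis inner_mul_eq inner_commute)
  define a' where "a' = a - (\<Sum>b\<in>C. (a \<bullet> (S *v b)) *\<^sub>R b)"
  have perp: "a' \<bullet> (S *v c) = 0" if "c \<in> C" for c
  proof -
    have "(\<Sum>b\<in>C. (a \<bullet> (S *v b)) * (b \<bullet> (S *v c))) = (\<Sum>b\<in>C. if b = c then a \<bullet> (S *v b) else 0)"
      using C(3) that by (intro sum.cong) (auto simp: orthonormal_wrt_def)
    then show ?thesis
      using that C(1) by (simp add: a'_def inner_diff_left inner_sum_left)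
  qed
  show ?case
  proof (cases "a' = 0")
    case True
    then have "a = (\<Sum>b\<in>C. (a \<bullet> (S *v b)) *\<^sub>R b)" by (simp add: a'_def)
    also have "\<dots> \<in> span C" by (intro span_sum span_scale span_base)
    finally have "a \<in> span C" .
    then show ?thesis using C by blast
  next
    case False
    define q where "q = a' \<bullet> (S *v a')"
    have q: "q > 0" using S False by (simp add: q_def pos_def_def)
    define e where "e = (1 / sqrt q) *\<^sub>R a'"
    have ee: "e \<bullet> (S *v e) = 1"
      using q by (simp add: e_def matrix_vector_mult_scaleR flip: q_def)
    have ec: "e \<bullet> (S *v c) = 0" if "c \<in> C" for c using perp[OF that] by (simp add: e_def)
    have ce: "c \<bullet> (S *v e) = 0" if "c \<in> C" for c using ec[OF that] sym[of c e] by simp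
    have "orthonormal_wrt S (insert e C)"
      using C(3) ee ec ce unfolding orthonormal_wrt_def by auto
    moreover have "a \<in> span (insert e C)"
    proof -
      have "a = sqrt q *\<^sub>R e + (\<Sum>b\<in>C. (a \<bullet> (S *v b)) *\<^sub>R b)"
        using q by (simp add: e_def a'_def)
      also have "\<dots> \<in> span (insert e C)"
        by (intro span_add span_sum span_scale span_base) auto
      finally show ?thesis .
    qed
    moreover have "F \<subseteq> span (insert e C)" using C(4) span_mono[of C "insert e C"] by blast
    ultimately show ?thesis using C by (intro exI[of _ "insert e C"]) auto
  qed
qed

lemma orthonormal_basis_extension:
  fixes S :: "real^'d^'d"
  assumes S: "pos_def S" and B: "finite B" "orthonormal_wrt S B"
  shows "\<exists>C. finite C \<and> B \<subseteq> C \<and> orthonormal_wrt S C \<and> card C = CARD('d)"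
proof -
  obtain C where C: "finite C" "B \<subseteq> C" "orthonormal_wrt S C" "Basis \<subseteq> span C"
    using gram_schmidt_wrt[OF S B finite_Basis] by blast
  \<comment> \<open>pairing a vanishing combination of \<open>C\<close> with one of its members isolates that coefficient\<close>
  have "independent C"
    unfolding independent_explicit_module
  proof safe
    fix t u and v :: "real^'d"
    assume t: "finite t" "t \<subseteq> C" and u: "(\<Sum>v\<in>t. u v *\<^sub>R v) = 0" and v: "v \<in> t"
    have "(\<Sum>b\<in>t. u b * (b \<bullet> (S *v v))) = (\<Sum>b\<in>t. if b = v then u b else 0)"
      using C(3) t(2) v by (intro sum.cong) (auto simp: orthonormal_wrt_def subset_iff)
    moreover have "(\<Sum>b\<in>t. u b * (b \<bullet> (S *v v))) = (\<Sum>b\<in>t. u b *\<^sub>R b) \<bullet> (S *v v)"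
      by (simp add: inner_sum_left)
    ultimately show "u v = 0" using t v u by simp
  qed
  moreover have "span C = UNIV" using C(4) by (metis span_Basis span_minimal subspace_span top.extremum_unique)
  ultimately have "card C = dim (UNIV :: (real^'d) set)" by (metis dim_span dim_eq_card_independent)
  then show ?thesis using C by (auto simp: dim_UNIV)
qed

lemma whitening_matrix_of_orthonormal:
  fixes S :: "real^'d^'d"
  assumes C: "finite C" "orthonormal_wrt S C" "card C = CARD('d)"
  obtains T :: "real^'d^'d" where "T ** S ** transpose T = mat 1" "bij_betw (\<lambda>k. row k T) UNIV C"
proof -
  obtain g where g: "bij_betw g (UNIV :: 'd set) C"
    using C by (metis bij_betw_iff_card finite)
  define T :: "real^'d^'d" where "T = (\<chi> k. g k)"
  have rT: "row k T = g k" for k by (simp add: row_def T_def vec_lambda_eta)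
  have "T ** S ** transpose T = mat 1"
    using C(2) g unfolding vec_eq_iff
    by (auto simp: congruence_component rT mat_def orthonormal_wrt_def bij_betw_def inj_eq)
  moreover have "(\<lambda>k. row k T) = g" using rT by blast
  ultimately show ?thesis using g that by simp
qed

lemma whitening_exists:
  fixes S :: "real^'d^'d"
  assumes S: "pos_def S"
  obtains T :: "real^'d^'d" where "T ** S ** transpose T = mat 1"
proof -
  obtain C where "finite C" "orthonormal_wrt S C" "card C = CARD('d)"
    using orthonormal_basis_extension[OF S, of "{}"] by (auto simp: orthonormal_wrt_def)
  then show ?thesis using that whitening_matrix_of_orthonormal by metis
qed

text \<open>
  A rectangular \<open>W\<close> with orthonormal rows selects only part of the coordinates of a whitened
  vector. Completing its rows to an orthonormal basis exhibits \<open>W *v v\<close> as a choice of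
  coordinates of \<open>T *v v\<close> with \<open>T\<close> square, so that a change of variables is available.
\<close>
lemma whitening_extension:
  fixes S :: "real^'d^'d" and W :: "real^'d^'r"
  assumes S: "pos_def S" and W: "W ** S ** transpose W = mat 1"
  obtains T :: "real^'d^'d" and f :: "'r \<Rightarrow> 'd"
  where "T ** S ** transpose T = mat 1" "inj f" "\<And>i. row (f i) T = row i W"
proof -
  have Wij: "row i W \<bullet> (S *v row j W) = (if i = j then 1 else 0)" for i j
    using congruence_component[of W S i j] W by (simp add: mat_def)
  have injW: "inj (\<lambda>i. row i W)"
    using Wij by (intro injI) (metis zero_neq_one)
  have "orthonormal_wrt S (range (\<lambda>i. row i W))"
    using Wij injD[OF injW] by (auto simp: orthonormal_wrt_def)
  then obtain C where C: "finite C" "range (\<lambda>i. row i W) \<subseteq> C" "orthonormal_wrt S C" "card C = CARD('d)"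
    using orthonormal_basis_extension[OF S] by (metis finite finite_imageI)
  obtain T :: "real^'d^'d" where T: "T ** S ** transpose T = mat 1" "bij_betw (\<lambda>k. row k T) UNIV C"
    using whitening_matrix_of_orthonormal[OF C(1,3,4)] by blast
  define f where "f = (\<lambda>i. the_inv_into UNIV (\<lambda>k. row k T) (row i W))"
  have row_f: "row (f i) T = row i W" for i
    using f_the_inv_into_f_bij_betw[OF T(2), of "row i W"] C(2) by (auto simp: f_def)
  have "inj f" using injW row_f by (metis (mono_tags, lifting) inj_def)
  with T(1) show ?thesis using row_f by (rule that)
qed

text \<open>
  Positivity at \<open>v \<noteq> 0\<close> reduces to \<open>transpose P *v v \<noteq> 0\<close>, which invertibility guarantees.
\<close>
lemma pos_def_congruence:
  fixes S :: "real^'d^'d" and P :: "real^'d^'r"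
  assumes S: "pos_def S" and inv: "invertible (P ** S ** transpose P)"
  shows "pos_def (P ** S ** transpose P)"
  unfolding pos_def_def
proof safe
  show "transpose (P ** S ** transpose P) = P ** S ** transpose P"
    using S by (simp add: matrix_transpose_mul matrix_mul_assoc pos_def_def)
  fix v :: "real^'r" assume v: "v \<noteq> 0"
  obtain K where "K ** (P ** S ** transpose P) = mat 1" using inv unfolding invertible_def by blast
  then have "(P ** S ** transpose P) *v v \<noteq> 0"
    using v by (metis matrix_vector_mul_assoc matrix_vector_mul_lid matrix_vector_mult_0_right)
  then have "transpose P *v v \<noteq> 0"
    by (metis matrix_vector_mul_assoc matrix_vector_mult_0_right)
  then show "v \<bullet> ((P ** S ** transpose P) *v v) > 0"
    using S by (simp add: quadratic_form_congruence pos_def_def)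
qed

section \<open>Lebesgue measure under a linear bijection\<close>

lemma nn_integral_lborel_plus:
  fixes f :: "'a::euclidean_space \<Rightarrow> ennreal"
  assumes [measurable]: "f \<in> borel_measurable borel"
  shows "(\<integral>\<^sup>+x. f (c + x) \<partial>lborel) = (\<integral>\<^sup>+x. f x \<partial>lborel)"
proof -
  have "(\<integral>\<^sup>+x. f x \<partial>lborel) = (\<integral>\<^sup>+x. f x \<partial>distr lborel borel ((+) c))"
    by (simp add: lborel_distr_plus)
  also have "\<dots> = (\<integral>\<^sup>+x. f (c + x) \<partial>lborel)"
    by (rule nn_integral_distr) simp_all
  finally show ?thesis ..
qed

text \<open>
  A linear bijection rescales Lebesgue measure, by the argument that proves uniqueness of Haar
  measure: inserting a factor \<open>\<integral> g = 1\<close>, shifting it by \<open>- L x\<close>, exchanging the integrals, and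
  shifting \<open>x\<close> by a preimage of \<open>y\<close> under \<open>L\<close> separates the double integral into a product. The
  scaling factor appears as an integral of \<open>g\<close> and is not evaluated as a determinant; where the
  lemma is used, it is fixed by total mass.
\<close>
lemma nn_integral_lborel_linear:
  fixes f g :: "'a::euclidean_space \<Rightarrow> ennreal" and L :: "'a \<Rightarrow> 'a"
  assumes f[measurable]: "f \<in> borel_measurable borel" and g[measurable]: "g \<in> borel_measurable borel"
    and g1: "(\<integral>\<^sup>+x. g x \<partial>lborel) = 1" and L: "linear L" and surj: "surj L"
  shows "(\<integral>\<^sup>+x. f (L x) \<partial>lborel) = (\<integral>\<^sup>+x. g (- L x) \<partial>lborel) * (\<integral>\<^sup>+x. f x \<partial>lborel)"
proof -
  have [measurable]: "L \<in> borel_measurable borel"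
    using L by (intro borel_measurable_continuous_onI linear_continuous_on) (simp add: linear_conv_bounded_linear)
  have "(\<integral>\<^sup>+x. f (L x) \<partial>lborel) = (\<integral>\<^sup>+x. f (L x) * (\<integral>\<^sup>+y. g (- L x + y) \<partial>lborel) \<partial>lborel)"
    by (subst nn_integral_lborel_plus[where f = g]) (simp_all add: g1)
  also have "\<dots> = (\<integral>\<^sup>+x. (\<integral>\<^sup>+y. f (L x) * g (- L x + y) \<partial>lborel) \<partial>lborel)"
    by (simp add: nn_integral_cmult)
  also have "\<dots> = (\<integral>\<^sup>+y. (\<integral>\<^sup>+x. f (L x) * g (- L x + y) \<partial>lborel) \<partial>lborel)"
    by (rule lborel_pair.Fubini'[symmetric]) simp
  also have "\<dots> = (\<integral>\<^sup>+y. (\<integral>\<^sup>+x. f (y + L x) * g (- L x) \<partial>lborel) \<partial>lborel)"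
  proof (rule nn_integral_cong)
    fix y :: 'a
    obtain c where c: "y = L c" using surj by (metis surjD)
    have "(\<integral>\<^sup>+x. f (L x) * g (- L x + y) \<partial>lborel) = (\<integral>\<^sup>+x. f (L (c + x)) * g (- L (c + x) + y) \<partial>lborel)"
      by (rule nn_integral_lborel_plus[symmetric]) simp
    then show "(\<integral>\<^sup>+x. f (L x) * g (- L x + y) \<partial>lborel) = (\<integral>\<^sup>+x. f (y + L x) * g (- L x) \<partial>lborel)"
      by (simp add: linear_add[OF L] c)
  qed
  also have "\<dots> = (\<integral>\<^sup>+x. (\<integral>\<^sup>+y. f (y + L x) * g (- L x) \<partial>lborel) \<partial>lborel)"
    by (rule lborel_pair.Fubini') simp
  also have "\<dots> = (\<integral>\<^sup>+x. (\<integral>\<^sup>+y. f (L x + y) \<partial>lborel) * g (- L x) \<partial>lborel)"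
    by (simp add: nn_integral_multc add.commute)
  also have "\<dots> = (\<integral>\<^sup>+x. g (- L x) \<partial>lborel) * (\<integral>\<^sup>+x. f x \<partial>lborel)"
    by (simp add: nn_integral_lborel_plus nn_integral_cmult mult.commute)
  finally show ?thesis .
qed

section \<open>The standard Gaussian measure and the chi-squared distribution\<close>

definition std_gauss_density :: "real^'d \<Rightarrow> real" where
  "std_gauss_density z = (\<Prod>i\<in>UNIV. std_normal_density (z $ i))"

definition std_gauss :: "(real^'d) measure" where
  "std_gauss = density lborel (\<lambda>z. ennreal (std_gauss_density z))"

lemma std_gauss_density_pos: "0 < std_gauss_density z"
  by (simp add: std_gauss_density_def prod_pos normal_density_pos)

lemma std_gauss_density_nonneg: "0 \<le> std_gauss_density z"
  by (simp add: less_imp_le std_gauss_density_pos)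

lemma measurable_std_gauss_density [measurable]: "std_gauss_density \<in> borel_measurable borel"
  unfolding std_gauss_density_def[abs_def] by measurable

lemma sets_std_gauss [measurable_cong, simp]: "sets std_gauss = sets borel"
  by (simp add: std_gauss_def)

lemma space_std_gauss [simp]: "space std_gauss = UNIV"
  by (simp add: std_gauss_def)

lemma exp_norm_eq_std_gauss_density:
  "exp (- (z \<bullet> z) / 2) = sqrt (2 * pi) ^ CARD('d) * std_gauss_density z" for z :: "real^'d"
proof -
  have "- (z \<bullet> z) / 2 = (\<Sum>i\<in>UNIV. - (z $ i)\<^sup>2 / 2)"
    by (simp add: inner_vec_def power2_eq_square sum_negf sum_divide_distrib)
  then have "exp (- (z \<bullet> z) / 2) = (\<Prod>i\<in>UNIV. exp (- (z $ i)\<^sup>2 / 2))"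
    by (simp add: exp_sum)
  also have "\<dots> = (\<Prod>i\<in>UNIV. sqrt (2 * pi) * std_normal_density (z $ i))"
    by (intro prod.cong) (simp_all add: std_normal_density_def)
  finally show ?thesis by (simp add: std_gauss_density_def prod.distrib)
qed

lemma nn_integral_lborel_vec_prod:
  fixes f :: "'d::finite \<Rightarrow> real \<Rightarrow> ennreal"
  assumes [measurable]: "\<And>i. f i \<in> borel_measurable borel"
  shows "(\<integral>\<^sup>+z. (\<Prod>i\<in>UNIV. f i (z $ i)) \<partial>(lborel :: (real^'d) measure)) = (\<Prod>i\<in>UNIV. \<integral>\<^sup>+x. f i x \<partial>lborel)"
proof -
  define ix :: "real^'d \<Rightarrow> 'd" where "ix = the_inv (\<lambda>i. axis i 1)"
  have inj: "inj (\<lambda>i. axis i 1 :: real^'d)" by (simp add: inj_def axis_eq_axis)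
  have B: "(Basis :: (real^'d) set) = range (\<lambda>i. axis i 1)" by (auto simp: Basis_vec_def)
  have ix: "ix (axis i 1) = i" for i unfolding ix_def by (rule the_inv_f_f[OF inj])
  have "(\<integral>\<^sup>+z. (\<Prod>b\<in>Basis. f (ix b) (z \<bullet> b)) \<partial>(lborel :: (real^'d) measure)) = (\<Prod>b\<in>Basis. \<integral>\<^sup>+x. f (ix b) x \<partial>lborel)"
    by (rule nn_integral_lborel_prod) simp_all
  then show ?thesis by (simp add: B prod.reindex[OF inj] o_def ix cart_eq_inner_axis)
qed

text \<open>
  The coordinates of a standard Gaussian vector are independent standard normal variables. This
  connects the density on \<open>real^'d\<close> to the product measure in the definition of
  \<open>chi_squared\<close>.
\<close>
lemma distr_std_gauss_coords:
  "distr (std_gauss :: (real^'d) measure) (PiM UNIV (\<lambda>_. density lborel std_normal_density)) (\<lambda>z k. z $ k)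
    = PiM UNIV (\<lambda>_::'d. density lborel std_normal_density)"
    (is "distr _ (PiM UNIV ?N) ?c = _")
proof -
  interpret N: prob_space "density lborel std_normal_density" by (simp add: prob_space_normal_density)
  interpret product_sigma_finite ?N ..
  have c[measurable]: "?c \<in> measurable std_gauss (PiM UNIV ?N)"
    by (rule measurable_PiM_single') auto
  show ?thesis
  proof (rule PiM_eqI)
    fix A :: "'d \<Rightarrow> real set"
    assume "\<And>i. i \<in> UNIV \<Longrightarrow> A i \<in> sets (?N i)"
    then have A[measurable]: "A i \<in> sets borel" for i by simp
    have "emeasure (distr std_gauss (PiM UNIV ?N) ?c) (Pi\<^sub>E UNIV A) = emeasure std_gauss (?c -` Pi\<^sub>E UNIV A \<inter> space std_gauss)"
      by (rule emeasure_distr) (auto intro!: sets_PiM_I_finite)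
    also have "\<dots> = (\<integral>\<^sup>+z. ennreal (std_gauss_density z) * indicator (?c -` Pi\<^sub>E UNIV A) z \<partial>lborel)"
    proof -
      have "?c -` Pi\<^sub>E UNIV A \<inter> space std_gauss \<in> sets std_gauss"
        by (rule measurable_sets[OF c]) (auto intro!: sets_PiM_I_finite)
      then show ?thesis by (simp add: std_gauss_def emeasure_density)
    qed
    also have "\<dots> = (\<integral>\<^sup>+z. (\<Prod>i\<in>UNIV. ennreal (std_normal_density (z $ i)) * indicator (A i) (z $ i)) \<partial>lborel)"
    proof (rule nn_integral_cong)
      fix z :: "real^'d"
      have "(indicator (?c -` Pi\<^sub>E UNIV A) z :: ennreal) = (\<Prod>i\<in>UNIV. indicator (A i) (z $ i))"
        by (auto simp: indicator_def PiE_UNIV_domain Pi_def)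
      then show "ennreal (std_gauss_density z) * indicator (?c -` Pi\<^sub>E UNIV A) z =
          (\<Prod>i\<in>UNIV. ennreal (std_normal_density (z $ i)) * indicator (A i) (z $ i))"
        by (simp add: std_gauss_density_def prod.distrib prod_ennreal)
    qed
    also have "\<dots> = (\<Prod>i\<in>UNIV. \<integral>\<^sup>+x. ennreal (std_normal_density x) * indicator (A i) x \<partial>lborel)"
      by (rule nn_integral_lborel_vec_prod) measurable
    also have "\<dots> = (\<Prod>i\<in>UNIV. emeasure (?N i) (A i))"
      by (simp add: emeasure_density)
    finally show "emeasure (distr std_gauss (PiM UNIV ?N) ?c) (Pi\<^sub>E UNIV A) = (\<Prod>i\<in>UNIV. emeasure (?N i) (A i))" .
  qed simp_all
qed

lemma prob_space_std_gauss: "prob_space (std_gauss :: (real^'d) measure)"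
proof (rule prob_spaceI)
  have "emeasure (std_gauss :: (real^'d) measure) UNIV = (\<integral>\<^sup>+z. (\<Prod>i\<in>UNIV. ennreal (std_normal_density (z $ i))) \<partial>(lborel :: (real^'d) measure))"
    by (simp add: std_gauss_def emeasure_density std_gauss_density_def prod_ennreal)
  also have "\<dots> = (\<Prod>i::'d\<in>UNIV. \<integral>\<^sup>+x. ennreal (std_normal_density x) \<partial>lborel)"
    by (rule nn_integral_lborel_vec_prod) measurable
  also have "(\<integral>\<^sup>+x. ennreal (std_normal_density x) \<partial>lborel) = 1"
    using prob_space.emeasure_space_1[OF prob_space_normal_density[of 1 0]] by (simp add: emeasure_density)
  finally show "emeasure (std_gauss :: (real^'d) measure) (space std_gauss) = 1" by simp
qed

lemma nn_integral_std_gauss_density: "(\<integral>\<^sup>+z. ennreal (std_gauss_density z) \<partial>(lborel :: (real^'d) measure)) = 1"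
  using prob_space.emeasure_space_1[OF prob_space_std_gauss] by (simp add: std_gauss_def emeasure_density)

text \<open>
  Reindexing a product measure along an injection forgets the remaining coordinates.
\<close>
lemma distr_std_gauss_sum_squares:
  fixes f :: "'r::finite \<Rightarrow> 'd::finite"
  assumes f: "inj f"
  shows "distr (std_gauss :: (real^'d) measure) borel (\<lambda>z. \<Sum>i\<in>UNIV. (z $ f i)\<^sup>2) = chi_squared CARD('r)"
proof -
  let ?n = "density lborel std_normal_density"
  have N: "prob_space ?n" by (simp add: prob_space_normal_density)
  obtain g where g: "bij_betw g {..<CARD('r)} (UNIV :: 'r set)"
    using ex_bij_betw_nat_finite[of "UNIV :: 'r set"] by (auto simp: atLeast0LessThan)
  let ?s = "\<lambda>z. \<Sum>i<CARD('r). (z i)\<^sup>2 :: real"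
  let ?t = "\<lambda>\<omega>::'d \<Rightarrow> real. \<lambda>n\<in>{..<CARD('r)}. \<omega> (f (g n))"
  have r: "distr (PiM UNIV (\<lambda>_::'d. ?n)) (PiM {..<CARD('r)} (\<lambda>_. ?n)) ?t = PiM {..<CARD('r)} (\<lambda>_. ?n)"
    by (rule distr_PiM_reindex)
       (use N g f in \<open>auto simp: inj_on_def bij_betw_def inj_def\<close>)
  have t[measurable]: "?t \<in> measurable (PiM UNIV (\<lambda>_::'d. ?n)) (PiM {..<CARD('r)} (\<lambda>_. ?n))"
    by (rule measurable_restrict) simp
  have c[measurable]: "(\<lambda>z k. z $ k) \<in> measurable (std_gauss :: (real^'d) measure) (PiM UNIV (\<lambda>_::'d. ?n))"
    by (rule measurable_PiM_single') auto
  have s[measurable]: "?s \<in> borel_measurable (PiM {..<CARD('r)} (\<lambda>_. ?n))"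
    by (intro borel_measurable_sum borel_measurable_power) (auto intro!: measurable_component_singleton[THEN measurable_compose])
  have "chi_squared CARD('r) = distr (PiM {..<CARD('r)} (\<lambda>_. ?n)) borel ?s"
    by (simp add: chi_squared_def)
  also have "\<dots> = distr (distr (distr (std_gauss :: (real^'d) measure) (PiM UNIV (\<lambda>_. ?n)) (\<lambda>z k. z $ k))
      (PiM {..<CARD('r)} (\<lambda>_. ?n)) ?t) borel ?s"
    by (simp add: distr_std_gauss_coords r)
  also have "\<dots> = distr (std_gauss :: (real^'d) measure) borel (\<lambda>z. ?s (?t (\<lambda>k. z $ k)))"
    by (subst distr_distr, measurable)+ (simp add: o_def)
  also have "(\<lambda>z::real^'d. ?s (?t (\<lambda>k. z $ k))) = (\<lambda>z. \<Sum>i\<in>UNIV. (z $ f i)\<^sup>2)"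
    using sum.reindex_bij_betw[OF g, of "\<lambda>i. (_ $ f i)\<^sup>2"] by (auto simp: fun_eq_iff)
  finally show ?thesis ..
qed

text \<open>
  Realising the chi-squared law as that of a squared norm turns statements about its distribution
  function into statements about spheres and balls.
\<close>
lemma distr_std_gauss_norm:
  "distr (std_gauss :: (real^'r) measure) borel (\<lambda>z. (norm z)\<^sup>2) = chi_squared CARD('r)"
proof -
  have "(norm z)\<^sup>2 = (\<Sum>i\<in>UNIV. (z $ i)\<^sup>2)" for z :: "real^'r"
    by (simp add: norm_eq_sqrt_inner inner_vec_def power2_eq_square sum_nonneg)
  then show ?thesis using distr_std_gauss_sum_squares[of "\<lambda>i::'r. i"] by simp
qed

lemma null_set_std_gauss:
  "A \<in> null_sets lborel \<Longrightarrow> measure std_gauss A = 0" for A :: "(real^'d) set"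
proof -
  assume "A \<in> null_sets lborel"
  then have "A \<in> null_sets (std_gauss :: (real^'d) measure)"
    unfolding std_gauss_def by (subst null_sets_density_iff) (auto dest: AE_not_in)
  then show ?thesis by (simp add: measure_def null_setsD1)
qed

lemma std_gauss_ball_pos: "0 < r \<Longrightarrow> 0 < measure std_gauss (ball c r)" for c :: "real^'d"
proof (rule ccontr)
  interpret prob_space "std_gauss :: (real^'d) measure" by (rule prob_space_std_gauss)
  assume r: "0 < r" and "\<not> 0 < measure std_gauss (ball c r)"
  then have "ball c r \<in> null_sets (std_gauss :: (real^'d) measure)"
    by (simp add: measure_le_0_iff null_sets_def emeasure_eq_measure not_less)
  then have "AE z in lborel. z \<in> ball c r \<longrightarrow> ennreal (std_gauss_density z) = 0"
    unfolding std_gauss_def by (subst (asm) null_sets_density_iff) auto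
  then have "AE z in lborel. z \<notin> ball c r"
    by eventually_elim (auto simp: ennreal_eq_0_iff not_le std_gauss_density_pos simp flip: not_less)
  then have "emeasure lborel (ball c r) = 0"
    by (subst (asm) AE_iff_null_sets[symmetric]) auto
  then show False
    using r emeasure_ball[of r c] unit_ball_vol_pos[of "real CARD('d)"] by simp
qed

text \<open>
  The distribution function has no jumps because spheres are null sets, and it increases strictly
  on the nonnegative reals because every spherical shell contains a ball. Both are needed to invert
  it: strict monotonicity makes the inverse well defined, and continuity together with the limits
  \<open>0\<close> and \<open>1\<close> shows that every probability in between is attained.
\<close>
lemma cdf_chi_squared_inj_range:
  shows cdf_chi_squared_inj: "inj_on (cdf (chi_squared CARD('r::finite))) {0..}" (is ?inj)
    and cdf_chi_squared_range: "{0<..<1} \<subseteq> cdf (chi_squared CARD('r)) ` {0..}" (is ?sub)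
proof -
  interpret G: prob_space "std_gauss :: (real^'r) measure" by (rule prob_space_std_gauss)
  define X where "X = chi_squared CARD('r)"
  have X: "X = distr (std_gauss :: (real^'r) measure) borel (\<lambda>z. (norm z)\<^sup>2)"
    by (simp add: X_def distr_std_gauss_norm)
  interpret real_distribution X unfolding X by (rule G.real_distribution_distr) simp
  have m: "measure X A = measure std_gauss ((\<lambda>z::real^'r. (norm z)\<^sup>2) -` A)" if "A \<in> sets borel" for A
    using that by (simp add: X measure_distr)
  have vm: "(\<lambda>z::real^'r. (norm z)\<^sup>2) -` A \<in> sets borel" if "A \<in> sets borel" for A
    using measurable_sets[of "\<lambda>z::real^'r. (norm z)\<^sup>2" borel borel A] that by simp
  have atom: "measure X {x} = 0" for x
  proof -
    have "(\<lambda>z::real^'r. (norm z)\<^sup>2) -` {x} \<subseteq> sphere 0 (sqrt x)" by (auto simp: real_sqrt_unique)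
    moreover have "sphere 0 (sqrt x) \<in> null_sets (lborel :: (real^'r) measure)"
      using negligible_sphere[of "0::real^'r" "sqrt x"]
      by (auto simp: null_sets_completion_iff negligible_iff_null_sets)
    ultimately have "measure X {x} \<le> measure (std_gauss :: (real^'r) measure) (sphere 0 (sqrt x))"
      by (simp add: m) (intro G.finite_measure_mono, auto)
    also have "\<dots> = 0" by (rule null_set_std_gauss) fact
    finally show ?thesis by (simp add: measure_le_0_iff)
  qed
  have strict: "cdf X a < cdf X b" if ab: "0 \<le> a" "a < b" for a b
  proof -
    \<comment> \<open>a ball centred halfway between the two spheres that touches both\<close>
    obtain i :: 'r where True by simp
    define p where "p = (sqrt a + sqrt b) / 2" 
    define \<rho> where "\<rho> = (sqrt b - sqrt a) / 2"
    have \<rho>: "0 < \<rho>" using ab by (simp add: \<rho>_def)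
    have "ball (p *\<^sub>R axis i 1) \<rho> \<subseteq> (\<lambda>z::real^'r. (norm z)\<^sup>2) -` {a<..b}"
    proof
      fix z :: "real^'r" assume "z \<in> ball (p *\<^sub>R axis i 1) \<rho>"
      then have d: "norm (p *\<^sub>R axis i 1 - z) < \<rho>" by (simp add: dist_norm)
      have p: "norm (p *\<^sub>R axis i 1 :: real^'r) = p" using ab by (simp add: p_def)
      have "norm z < sqrt b"
        using d p norm_triangle_ineq2[of z "p *\<^sub>R axis i 1"] by (simp add: norm_minus_commute \<rho>_def p_def field_simps)
      moreover have "sqrt a < norm z"
        using d p norm_triangle_ineq2[of "p *\<^sub>R axis i 1" z] by (simp add: \<rho>_def p_def field_simps)
      ultimately show "z \<in> (\<lambda>z. (norm z)\<^sup>2) -` {a<..b}"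
        using ab power_strict_mono[of "norm z" "sqrt b" 2] power_strict_mono[of "sqrt a" "norm z" 2] by simp
    qed
    then have "measure std_gauss (ball (p *\<^sub>R axis i 1 :: real^'r) \<rho>) \<le> measure X {a<..b}"
      by (simp add: m) (intro G.finite_measure_mono, auto intro: vm)
    then have "0 < measure X {a<..b}"
      using std_gauss_ball_pos[OF \<rho>] by (meson less_le_trans)
    then show ?thesis using cdf_diff_eq[OF ab(2)] by simp
  qed
  show ?inj unfolding X_def[symmetric]
    using strict by (intro linorder_inj_onI') (auto simp: less_le)
  have zero: "cdf X 0 = 0"
  proof -
    have "(\<lambda>z::real^'r. (norm z)\<^sup>2) -` {..0} = (\<lambda>z::real^'r. (norm z)\<^sup>2) -` {0}" by auto
    then show ?thesis using atom[of 0] by (simp add: cdf_def m)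
  qed
  have cont: "continuous_on {0..c} (cdf X)" for c
    using atom isCont_cdf by (intro continuous_at_imp_continuous_on) blast
  show ?sub unfolding X_def[symmetric]
  proof
    fix p :: real assume p: "p \<in> {0<..<1}"
    have "eventually (\<lambda>x. p < cdf X x) at_top"
      using cdf_lim_at_top_prob p by (intro order_tendstoD) auto
    then have "eventually (\<lambda>x. 0 \<le> x \<and> p < cdf X x) at_top"
      by (intro eventually_conj eventually_ge_at_top)
    then obtain c where c: "0 \<le> c" "p < cdf X c" by (auto dest: eventually_happens)
    have "\<exists>x\<ge>0. x \<le> c \<and> cdf X x = p"
      using IVT'[of "cdf X" 0 p c] c p zero cont by auto
    then show "p \<in> cdf X ` {0..}" by auto
  qed
qed

lemma cdf_chi_squared_beta:
  assumes "0 < \<alpha>" "\<alpha> < 1"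
  shows "cdf (chi_squared CARD('r::finite)) ((beta CARD('r) \<alpha>)\<^sup>2) = 1 - \<alpha>" and "0 \<le> beta CARD('r) \<alpha>"
proof -
  let ?F = "cdf (chi_squared CARD('r))"
  have im: "1 - \<alpha> \<in> ?F ` {0..}" using cdf_chi_squared_range[where 'r='r] assms by auto
  have nn: "0 \<le> the_inv_into {0..} ?F (1 - \<alpha>)"
    using the_inv_into_into[OF cdf_chi_squared_inj im order_refl] by simp
  then show "?F ((beta CARD('r) \<alpha>)\<^sup>2) = 1 - \<alpha>"
    using f_the_inv_into_f[OF cdf_chi_squared_inj im] by (simp add: beta_def)
  show "0 \<le> beta CARD('r) \<alpha>" using nn by (simp add: beta_def)
qed

section \<open>The probability of a confidence ellipsoid\<close>

text \<open>
  The density of \<open>X\<close> is a constant times the standard Gaussian density at \<open>T *v X\<close>, so the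
  law of \<open>T *v X\<close> is a constant times \<open>std_gauss\<close>, and as both are probability measures the
  constant is one. This bypasses every determinant: the Jacobian of \<open>T\<close> and the normalising
  factor of the density only enter through that constant.
\<close>
lemma distr_whitened_gaussian:
  fixes S T :: "real^'d^'d" and X :: "'a \<Rightarrow> real^'d"
  assumes M: "prob_space M" and X: "distributed M lborel X (\<lambda>v. ennreal (mvnormal_density 0 S v))"
    and T: "T ** S ** transpose T = mat 1"
  shows "distr M borel (\<lambda>\<omega>. T *v X \<omega>) = std_gauss"
proof -
  \<comment> \<open>the sign of \<open>det S\<close> is left open: if it were not positive, \<open>ennreal K\<close> would be \<open>0\<close>,
    which the total mass excludes\<close>
  define K where "K = sqrt (2 * pi) ^ CARD('d) / sqrt ((2 * pi) ^ CARD('d) * det S)"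
  define \<kappa> where "\<kappa> = (\<integral>\<^sup>+v. ennreal (std_gauss_density (- (T *v v))) \<partial>lborel)"
  have dens: "ennreal (mvnormal_density 0 S v) = ennreal K * ennreal (std_gauss_density (T *v v))" for v
  proof -
    have "v \<bullet> (matrix_inv S *v v) = (T *v v) \<bullet> (T *v v)"
      unfolding matrix_inv_whitened[OF T] by (simp only: inner_mul_eq[of v "transpose T"] transpose_transpose flip: matrix_vector_mul_assoc)
    then have "mvnormal_density 0 S v = K * std_gauss_density (T *v v)"
      using exp_norm_eq_std_gauss_density[of "T *v v"] by (simp add: mvnormal_density_def K_def)
    then show ?thesis by (simp add: ennreal_mult'' std_gauss_density_nonneg)
  qed
  have Xm[measurable]: "X \<in> borel_measurable M" using distributed_measurable[OF X] by simp
  have Tm[measurable]: "(\<lambda>v. T *v v) \<in> borel_measurable borel"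
    by (intro borel_measurable_continuous_onI linear_continuous_on) simp
  have surj: "surj ((*v) T)"
    using T by (metis matrix_mul_assoc matrix_right_invertible_surjective)
  have em: "emeasure (distr M borel (\<lambda>\<omega>. T *v X \<omega>)) A = ennreal K * \<kappa> * emeasure std_gauss A"
    if [measurable]: "A \<in> sets borel" for A
  proof -
    have "emeasure (distr M borel (\<lambda>\<omega>. T *v X \<omega>)) A = (\<integral>\<^sup>+z. indicator A z \<partial>distr M borel (\<lambda>\<omega>. T *v X \<omega>))"
      by simp
    also have "\<dots> = (\<integral>\<^sup>+\<omega>. indicator A (T *v X \<omega>) \<partial>M)"
      by (rule nn_integral_distr) simp_all
    also have "\<dots> = (\<integral>\<^sup>+v. ennreal (mvnormal_density 0 S v) * indicator A (T *v v) \<partial>lborel)"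
      by (rule distributed_nn_integral[OF X, symmetric]) simp
    also have "\<dots> = ennreal K * (\<integral>\<^sup>+v. ennreal (std_gauss_density (T *v v)) * indicator A (T *v v) \<partial>lborel)"
      by (simp add: dens mult.assoc nn_integral_cmult)
    also have "(\<integral>\<^sup>+v. ennreal (std_gauss_density (T *v v)) * indicator A (T *v v) \<partial>lborel)
        = \<kappa> * (\<integral>\<^sup>+z. ennreal (std_gauss_density z) * indicator A z \<partial>lborel)"
      unfolding \<kappa>_def
      by (rule nn_integral_lborel_linear) (use surj in \<open>auto simp: nn_integral_std_gauss_density\<close>)
    also have "(\<integral>\<^sup>+z. ennreal (std_gauss_density z) * indicator A z \<partial>lborel) = emeasure std_gauss A"
      by (simp add: std_gauss_def emeasure_density)
    finally show ?thesis by (simp add: mult.assoc)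
  qed
  have "ennreal K * \<kappa> = 1"
  proof -
    interpret D: prob_space "distr M borel (\<lambda>\<omega>. T *v X \<omega>)" by (rule prob_space.prob_space_distr[OF M]) simp
    show ?thesis
      using em[of UNIV] D.emeasure_space_1 prob_space.emeasure_space_1[OF prob_space_std_gauss[where 'd='d]] by simp
  qed
  then show ?thesis using em by (intro measure_eqI) simp_all
qed

text \<open>
  Let \<open>U\<close> whiten the covariance \<open>K\<close> of \<open>P *v X\<close>. Then \<open>U ** P\<close> has rows that are orthonormal
  for \<open>S\<close>, and the quadratic form of \<open>matrix_inv K\<close> at \<open>P *v X\<close> is the sum of the squares of
  as many independent standard normal variables as \<open>P\<close> has rows. Membership in the ellipsoid is
  therefore the event that a chi-squared variable is at most its quantile.
\<close>
lemma prob_gaussian_in_ellipsoid: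
  fixes S :: "real^'d^'d" and P :: "real^'d^'r" and X :: "'a \<Rightarrow> real^'d"
  assumes M: "prob_space M" and X: "distributed M lborel X (\<lambda>v. ennreal (mvnormal_density 0 S v))"
    and S: "pos_def S" and inv: "invertible (P ** S ** transpose P)" and \<alpha>: "0 < \<alpha>" "\<alpha> < 1"
  shows "measure M {\<omega> \<in> space M. h + P *v X \<omega> \<in> ellipsoid h (P ** S ** transpose P) (beta CARD('r) \<alpha>)} = 1 - \<alpha>"
proof -
  define K where "K = P ** S ** transpose P"
  obtain U :: "real^'r^'r" where U: "U ** K ** transpose U = mat 1"
    unfolding K_def by (rule whitening_exists[OF pos_def_congruence[OF S inv]])
  have W: "(U ** P) ** S ** transpose (U ** P) = mat 1"
    using U by (simp add: K_def matrix_transpose_mul matrix_mul_assoc)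
  obtain T :: "real^'d^'d" and f :: "'r \<Rightarrow> 'd"
    where T: "T ** S ** transpose T = mat 1" and f: "inj f" and row: "\<And>i. row (f i) T = row i (U ** P)"
    by (rule whitening_extension[OF S W]) (rule that)
  have Q: "(P *v v) \<bullet> (matrix_inv K *v (P *v v)) = (\<Sum>i\<in>UNIV. ((T *v v) $ f i)\<^sup>2)" for v
  proof -
    have "(P *v v) \<bullet> (matrix_inv K *v (P *v v)) = (U *v (P *v v)) \<bullet> (U *v (P *v v))"
      unfolding matrix_inv_whitened[OF U]
      by (simp only: inner_mul_eq[of _ "transpose U"] transpose_transpose flip: matrix_vector_mul_assoc)
    also have "U *v (P *v v) = (\<chi> i. (T *v v) $ f i)"
      by (simp add: vec_eq_iff matrix_vector_mul_row row matrix_vector_mul_assoc)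
    finally show ?thesis by (simp add: inner_vec_def power2_eq_square)
  qed
  have Xm[measurable]: "X \<in> borel_measurable M" using distributed_measurable[OF X] by simp
  have Tm[measurable]: "(\<lambda>v. T *v v) \<in> borel_measurable borel"
    by (intro borel_measurable_continuous_onI linear_continuous_on) simp
  have [measurable]: "(\<lambda>\<omega>. (T *v X \<omega>) $ k) \<in> borel_measurable M" for k
    by (simp add: matrix_vector_mul_row)
  have "chi_squared CARD('r) = distr (distr M borel (\<lambda>\<omega>. T *v X \<omega>)) borel (\<lambda>z. \<Sum>i\<in>UNIV. (z $ f i)\<^sup>2)"
    by (simp add: distr_whitened_gaussian[OF M X T] distr_std_gauss_sum_squares[OF f])
  also have "\<dots> = distr M borel (\<lambda>\<omega>. \<Sum>i\<in>UNIV. ((T *v X \<omega>) $ f i)\<^sup>2)"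
    by (subst distr_distr) (simp_all add: o_def)
  finally have chi: "chi_squared CARD('r) = \<dots>" .
  have "1 - \<alpha> = measure (chi_squared CARD('r)) {..(beta CARD('r) \<alpha>)\<^sup>2}"
    using cdf_chi_squared_beta(1)[OF \<alpha>, where 'r = 'r] by (simp add: cdf_def)
  also have "\<dots> = measure M {\<omega> \<in> space M. (\<Sum>i\<in>UNIV. ((T *v X \<omega>) $ f i)\<^sup>2) \<le> (beta CARD('r) \<alpha>)\<^sup>2}"
    unfolding chi by (subst measure_distr) (auto intro!: arg_cong[where f = "measure M"])
  finally show ?thesis by (simp add: ellipsoid_def Q flip: K_def)
qed

section \<open>The second-order cone reformulation\<close>

text \<open>
  The maximum of the \<open>i\<close>-th coordinate over the ellipsoid is \<open>h $ i + \<beta> * norm (R *v row i P)\<close>.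
  With \<open>N v = R *v (transpose P *v v)\<close> one has \<open>N a \<bullet> N b = a \<bullet> (K *v b)\<close> for the shape matrix
  \<open>K\<close>, so that the points of the ellipsoid are \<open>h + K *v v\<close> with \<open>norm (N v) \<le> \<beta>\<close> and their
  \<open>i\<close>-th coordinate exceeds that of \<open>h\<close> by \<open>N (axis i 1) \<bullet> N v\<close>. Cauchy-Schwarz gives the
  upper bound, and it is attained where \<open>v\<close> is a multiple of \<open>axis i 1\<close>.
\<close>
lemma ellipsoid_subset_orthant_iff:
  fixes S :: "real^'d^'d" and P :: "real^'d^'r"
  assumes S: "pos_def S" and inv: "invertible (P ** S ** transpose P)"
    and R: "sym_sqrt_of R S" and \<beta>: "0 \<le> \<beta>"
  shows "ellipsoid h (P ** S ** transpose P) \<beta> \<subseteq> {e. \<forall>i. e $ i \<le> 0} \<longleftrightarrow>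
    (\<forall>i. h $ i + \<beta> * norm (R *v row i P) \<le> 0)"
proof -
  define K where "K = P ** S ** transpose P"
  define N where "N = (\<lambda>v. R *v (transpose P *v v))"
  obtain Ki where Ki: "Ki ** K = mat 1" "K ** Ki = mat 1" using inv unfolding invertible_def K_def by blast
  have mK: "matrix_inv K = Ki" by (rule matrix_inv_eqI) (rule Ki)
  have KiK: "Ki *v (K *v v) = v" "K *v (Ki *v v) = v" for v
    by (simp_all add: matrix_vector_mul_assoc Ki)
  have tR: "transpose R = R" and RR: "R ** R = S" using R by (simp_all add: sym_sqrt_of_def)
  have RS: "(R *v p) \<bullet> (R *v q) = p \<bullet> (S *v q)" for p q
    using inner_mul_eq[of p R "R *v q"] unfolding tR matrix_vector_mul_assoc RR by (rule sym)
  have NN: "N a \<bullet> N b = a \<bullet> (K *v b)" for a b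
    unfolding N_def RS K_def by (rule quadratic_form_congruence[symmetric])
  have Nax: "R *v row i P = N (axis i 1)" for i by (simp only: N_def transpose_mul_axis)
  have Kax: "(K *v v) $ i = N (axis i 1) \<bullet> N v" for i v
    by (simp add: NN inner_axis')
  have quad: "N v \<bullet> N v = (K *v v) \<bullet> (Ki *v (K *v v))" for v
    by (simp add: NN KiK inner_commute)
  show ?thesis unfolding K_def[symmetric]
  proof
    assume sub: "ellipsoid h K \<beta> \<subseteq> {e. \<forall>i. e $ i \<le> 0}"
    show "\<forall>i. h $ i + \<beta> * norm (R *v row i P) \<le> 0"
    proof
      fix i
      define a where "a = (axis i 1 :: real^'r)"
      define \<sigma> where "\<sigma> = norm (N a)"
      have "a \<bullet> (K *v a) > 0"
        using pos_def_congruence[OF S inv] by (simp add: a_def pos_def_def K_def)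
      then have \<sigma>: "\<sigma> > 0" "N a \<bullet> N a = \<sigma>\<^sup>2" by (auto simp: \<sigma>_def power2_norm_eq_inner simp flip: NN)
      \<comment> \<open>the point of the ellipsoid at which the \<open>i\<close>-th coordinate is largest\<close>
      define e where "e = h + (\<beta> / \<sigma>) *\<^sub>R (K *v a)"
      have "(e - h) \<bullet> (Ki *v (e - h)) = (\<beta> / \<sigma>)\<^sup>2 * (N a \<bullet> N a)"
        by (simp add: e_def matrix_vector_mult_scaleR quad power2_eq_square)
      also have "\<dots> = \<beta>\<^sup>2" using \<sigma> by (simp add: power_divide)
      finally have "e \<in> ellipsoid h K \<beta>" by (simp add: ellipsoid_def mK)
      then have "e $ i \<le> 0" using sub by auto
      moreover have "e $ i = h $ i + \<beta> * \<sigma>"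
        using \<sigma> Kax[of a i, folded a_def] by (simp add: e_def power2_eq_square)
      ultimately show "h $ i + \<beta> * norm (R *v row i P) \<le> 0" by (simp add: Nax \<sigma>_def a_def)
    qed
  next
    assume soc: "\<forall>i. h $ i + \<beta> * norm (R *v row i P) \<le> 0"
    show "ellipsoid h K \<beta> \<subseteq> {e. \<forall>i. e $ i \<le> 0}"
    proof safe
      fix e i assume e: "e \<in> ellipsoid h K \<beta>"
      define v where "v = Ki *v (e - h)"
      have Kv: "K *v v = e - h" by (simp add: v_def KiK)
      have "(norm (N v))\<^sup>2 \<le> \<beta>\<^sup>2"
        using e by (simp add: ellipsoid_def mK power2_norm_eq_inner quad Kv)
      then have Nv: "norm (N v) \<le> \<beta>" using \<beta> by (rule power2_le_imp_le)
      have "e $ i - h $ i = N (axis i 1) \<bullet> N v" using Kax[of v i] by (simp add: Kv)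
      also have "\<dots> \<le> norm (N (axis i 1)) * norm (N v)" by (rule norm_cauchy_schwarz)
      also have "\<dots> \<le> norm (N (axis i 1)) * \<beta>" by (intro mult_left_mono Nv) simp
      finally show "e $ i \<le> 0" using soc[rule_format, of i] by (simp add: Nax mult.commute)
    qed
  qed
qed

section \<open>Dependence on the policy\<close>

lemma eta_eq_h_plus_P:
  "eta Tx Tu y (xbar A B x0 \<theta> v) (ubar \<theta> v) = h_vec A B x0 Tx Tu y \<theta> + P_mat A B Tx Tu \<theta> *v v"
proof -
  have "Tx *v (Bbar A B *v (fst \<theta> *v v)) + Tu *v (fst \<theta> *v v) = ((Tx ** Bbar A B + Tu) ** fst \<theta>) *v v"
    by (simp add: matrix_vector_mult_add_rdistrib flip: matrix_vector_mul_assoc)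
  then show ?thesis
    by (simp add: eta_def xbar_def ubar_def h_vec_def P_mat_def matrix_vector_right_distrib
        matrix_vector_mult_add_rdistrib flip: matrix_vector_mul_assoc)
qed

lemma convex_policies: "convex policies"
  by (rule convexI) (auto simp: policies_def)

lemma matrix_vector_mult_combine:
  "(a *\<^sub>R C + b *\<^sub>R D) *v v = a *\<^sub>R (C *v v) + b *\<^sub>R (D *v v)" for C D :: "real^'n^'m"
  by (simp add: matrix_vector_mult_add_rdistrib scaleR_matrix_vector_assoc)

lemma matrix_vector_mult_combine_right:
  "C *v (a *\<^sub>R v + b *\<^sub>R w) = a *\<^sub>R (C *v v) + b *\<^sub>R (C *v w)" for C :: "real^'n^'m"
  by (simp add: matrix_vector_right_distrib matrix_vector_mult_scaleR)

lemma affine_combination_add: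
  "a + b = 1 \<Longrightarrow> c + (a *\<^sub>R v + b *\<^sub>R w) = a *\<^sub>R (c + v) + b *\<^sub>R (c + w)" for c :: "'a::real_vector"
  using scaleR_add_left[of a b c] by (simp add: scaleR_add_right)

text \<open>
  State, input, and constraint coefficients are affine in the policy. Convexity of the expected
  cost and of the cone constraints both follow from this.
\<close>
lemma ubar_affine:
  "ubar (a *\<^sub>R \<theta> + b *\<^sub>R \<theta>') v = a *\<^sub>R ubar \<theta> v + b *\<^sub>R ubar \<theta>' v"
  by (simp add: ubar_def matrix_vector_mult_combine scaleR_add_right)

lemma xbar_affine:
  assumes "a + b = 1"
  shows "xbar A B x0 (a *\<^sub>R \<theta> + b *\<^sub>R \<theta>') v = a *\<^sub>R xbar A B x0 \<theta> v + b *\<^sub>R xbar A B x0 \<theta>' v"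
proof -
  have x: "xbar A B x0 \<theta> v = (Abar A *v x0 + Dbar A *v v) + Bbar A B *v ubar \<theta> v" for \<theta>
    by (simp add: xbar_def)
  show ?thesis unfolding x ubar_affine matrix_vector_mult_combine_right
    by (rule affine_combination_add[OF assms])
qed

lemma h_vec_affine:
  assumes "a + b = 1"
  shows "h_vec A B x0 Tx Tu y (a *\<^sub>R \<theta> + b *\<^sub>R \<theta>') = a *\<^sub>R h_vec A B x0 Tx Tu y \<theta> + b *\<^sub>R h_vec A B x0 Tx Tu y \<theta>'"
  unfolding h_vec_def snd_add snd_scaleR matrix_vector_mult_combine_right
  by (rule affine_combination_add[OF assms])

lemma P_mat_affine:
  assumes "a + b = 1"
  shows "P_mat A B Tx Tu (a *\<^sub>R \<theta> + b *\<^sub>R \<theta>') = a *\<^sub>R P_mat A B Tx Tu \<theta> + b *\<^sub>R P_mat A B Tx Tu \<theta>'"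
proof -
  have P: "P_mat A B Tx Tu \<theta> *v v = (Tx ** Dbar A) *v v + (Tx ** Bbar A B + Tu) *v (fst \<theta> *v v)" for \<theta> v
    by (simp add: P_mat_def matrix_vector_mult_add_rdistrib matrix_vector_mul_assoc)
  show ?thesis
    unfolding matrix_eq
    by (simp add: P matrix_vector_mult_combine matrix_vector_mult_combine_right affine_combination_add[OF assms])
qed

text \<open>
  The left-hand side of each cone constraint is an affine function plus a nonnegative multiple of
  the norm of an affine function of the policy, hence convex.
\<close>
lemma convex_soc:
  assumes \<beta>: "0 \<le> \<beta>"
  shows "convex {\<theta> \<in> policies. \<forall>i. h_vec A B x0 Tx Tu y \<theta> $ i + \<beta> * norm (R *v row i (P_mat A B Tx Tu \<theta>)) \<le> 0}"
proof (rule convexI)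
  let ?h = "h_vec A B x0 Tx Tu y" and ?P = "P_mat A B Tx Tu"
  let ?F = "{\<theta> \<in> policies. \<forall>i. ?h \<theta> $ i + \<beta> * norm (R *v row i (?P \<theta>)) \<le> 0}"
  fix \<theta> \<theta>' and a b :: real
  assume \<theta>: "\<theta> \<in> ?F" "\<theta>' \<in> ?F" and ab: "0 \<le> a" "0 \<le> b" "a + b = 1"
  let ?c = "a *\<^sub>R \<theta> + b *\<^sub>R \<theta>'"
  have "?h ?c $ i + \<beta> * norm (R *v row i (?P ?c)) \<le> 0" for i
  proof -
    have row: "row i (?P ?c) = a *\<^sub>R row i (?P \<theta>) + b *\<^sub>R row i (?P \<theta>')"
      by (simp add: P_mat_affine[OF ab(3)] row_def vec_eq_iff)
    have "norm (R *v row i (?P ?c)) \<le> a * norm (R *v row i (?P \<theta>)) + b * norm (R *v row i (?P \<theta>'))"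
      using ab norm_triangle_ineq[of "a *\<^sub>R (R *v row i (?P \<theta>))" "b *\<^sub>R (R *v row i (?P \<theta>'))"]
      by (simp add: row matrix_vector_mult_combine_right)
    then have "?h ?c $ i + \<beta> * norm (R *v row i (?P ?c)) \<le>
        ?h ?c $ i + \<beta> * (a * norm (R *v row i (?P \<theta>)) + b * norm (R *v row i (?P \<theta>')))"
      using \<beta> by (simp add: mult_left_mono)
    also have "\<dots> = a * (?h \<theta> $ i + \<beta> * norm (R *v row i (?P \<theta>))) + b * (?h \<theta>' $ i + \<beta> * norm (R *v row i (?P \<theta>')))"
      by (simp add: h_vec_affine[OF ab(3)] algebra_simps)
    also have "\<dots> \<le> 0"
      using \<theta> ab(1,2) by (auto intro!: add_nonpos_nonpos intro: mult_nonneg_nonpos)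
    finally show ?thesis .
  qed
  moreover have "?c \<in> policies" using \<theta> ab by (intro convexD[OF convex_policies]) auto
  ultimately show "?c \<in> ?F" by blast
qed

lemma convex_expected_cost:
  fixes X :: "'a \<Rightarrow> real^('t::{finite,linorder} \<times> 'n::finite)"
    and V :: "(real^('t option \<times> 'n)) \<times> (real^('t \<times> 'm::finite)) \<Rightarrow> real"
  assumes V: "convex_on UNIV V"
    and int: "\<And>\<theta>. \<theta> \<in> policies \<Longrightarrow> integrable M (\<lambda>\<omega>. V (xbar A B x0 \<theta> (X \<omega>), ubar \<theta> (X \<omega>)))"
  shows "convex_on policies (\<lambda>\<theta>. \<integral>\<omega>. V (xbar A B x0 \<theta> (X \<omega>), ubar \<theta> (X \<omega>)) \<partial>M)"
  unfolding convex_on_def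
proof (intro conjI ballI allI impI convex_policies)
  fix \<theta> \<theta>' :: "('t, 'n, 'm) policy" and a b :: real
  assume \<theta>: "\<theta> \<in> policies" "\<theta>' \<in> policies" and ab: "0 \<le> a" "0 \<le> b" "a + b = 1"
  let ?V = "\<lambda>\<theta> \<omega>. V (xbar A B x0 \<theta> (X \<omega>), ubar \<theta> (X \<omega>))"
  let ?c = "a *\<^sub>R \<theta> + b *\<^sub>R \<theta>'"
  have "(\<integral>\<omega>. ?V ?c \<omega> \<partial>M) \<le> (\<integral>\<omega>. a * ?V \<theta> \<omega> + b * ?V \<theta>' \<omega> \<partial>M)"
  proof (rule integral_mono)
    show "integrable M (?V ?c)" using \<theta> ab by (intro int convexD[OF convex_policies])
    show "integrable M (\<lambda>\<omega>. a * ?V \<theta> \<omega> + b * ?V \<theta>' \<omega>)" using int \<theta> by simp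
    fix \<omega>
    have "(xbar A B x0 ?c (X \<omega>), ubar ?c (X \<omega>)) =
        a *\<^sub>R (xbar A B x0 \<theta> (X \<omega>), ubar \<theta> (X \<omega>)) + b *\<^sub>R (xbar A B x0 \<theta>' (X \<omega>), ubar \<theta>' (X \<omega>))"
      by (simp add: xbar_affine[OF ab(3)] ubar_affine)
    then show "?V ?c \<omega> \<le> a * ?V \<theta> \<omega> + b * ?V \<theta>' \<omega>"
      using V ab by (simp add: convex_on_def)
  qed
  also have "\<dots> = a * (\<integral>\<omega>. ?V \<theta> \<omega> \<partial>M) + b * (\<integral>\<omega>. ?V \<theta>' \<omega> \<partial>M)"
    using int \<theta> by simp
  finally show "(\<integral>\<omega>. ?V ?c \<omega> \<partial>M) \<le> a * (\<integral>\<omega>. ?V \<theta> \<omega> \<partial>M) + b * (\<integral>\<omega>. ?V \<theta>' \<omega> \<partial>M)" .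
qed

section \<open>The convex conservative approximation\<close>

theorem proposition7:
  fixes M :: "'a measure"
    and w :: "nat \<Rightarrow> 'a \<Rightarrow> real^'n"
    and A :: "real^'n^'n" and B :: "real^'m^'n" and x0 :: "real^'n"
    and Tx :: "real^('t::{finite,linorder} option \<times> 'n)^'r"
    and Tu :: "real^('t \<times> 'm)^'r"
    and y :: "real^'r"
    and \<Sigma> :: "real^('t \<times> 'n)^('t \<times> 'n)"
    and \<alpha> :: real
  defines "wbar \<equiv> (\<lambda>\<omega>. stack (\<lambda>t. w t \<omega>) :: real^('t \<times> 'n))"
  defines "x \<equiv> (\<lambda>\<theta> \<omega>. xbar A B x0 \<theta> (wbar \<omega>))"
  defines "u \<equiv> (\<lambda>\<theta> \<omega>. ubar \<theta> (wbar \<omega>))"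
  defines "h \<equiv> h_vec A B x0 Tx Tu y"
  defines "P \<equiv> P_mat A B Tx Tu"
  defines "\<Theta> \<equiv> (policies :: ('t, 'n, 'm) policy set)"
  defines "\<Sigma>\<^sub>\<theta> \<equiv> (\<lambda>\<theta>. P \<theta> ** \<Sigma> ** transpose (P \<theta>))"
  defines "\<beta> \<equiv> beta CARD('r) \<alpha>"
  defines "chance \<equiv> (\<lambda>\<theta>. measure M {\<omega> \<in> space M. \<forall>i. eta Tx Tu y (x \<theta> \<omega>) (u \<theta> \<omega>) $ i \<le> 0} \<ge> 1 - \<alpha>)"
  defines "ellip \<equiv> (\<lambda>\<theta>. ellipsoid (h \<theta>) (\<Sigma>\<^sub>\<theta> \<theta>) \<beta> \<subseteq> {e. \<forall>i. e $ i \<le> 0})"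
  defines "soc \<equiv> (\<lambda>R \<theta>. \<forall>i. h \<theta> $ i + \<beta> * norm (R *v row i (P \<theta>)) \<le> 0)"
  assumes "prob_space M"
    and "\<And>t. t < CARD('t) \<Longrightarrow> w t \<in> borel_measurable M"
    and "pos_def \<Sigma>"
    and "distributed M lborel wbar (\<lambda>v. ennreal (mvnormal_density 0 \<Sigma> v))"
    and "0 < \<alpha>" and "\<alpha> < 1"
  shows "(\<forall>\<theta>\<in>\<Theta>. invertible (\<Sigma>\<^sub>\<theta> \<theta>) \<longrightarrow>
            (ellip \<theta> \<longrightarrow> chance \<theta>) \<and>
            (\<forall>R. sym_sqrt_of R \<Sigma> \<longrightarrow> (ellip \<theta> \<longleftrightarrow> soc R \<theta>))) \<and>
         ((\<forall>\<theta>\<in>\<Theta>. invertible (\<Sigma>\<^sub>\<theta> \<theta>)) \<longrightarrow>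
            (\<forall>V :: (real^('t option \<times> 'n)) \<times> (real^('t \<times> 'm)) \<Rightarrow> real.
              \<forall>R. V \<in> borel_measurable borel \<longrightarrow> convex_on UNIV V \<longrightarrow>
                (\<forall>\<theta>\<in>\<Theta>. integrable M (\<lambda>\<omega>. V (x \<theta> \<omega>, u \<theta> \<omega>))) \<longrightarrow>
                sym_sqrt_of R \<Sigma> \<longrightarrow>
                (let J = (\<lambda>\<theta>. \<integral>\<omega>. V (x \<theta> \<omega>, u \<theta> \<omega>) \<partial>M) in
                 convex_conservative_approx
                   \<lparr>param_space = \<Theta>, objective = J, constraint = soc R\<rparr>
                   \<lparr>param_space = \<Theta>, objective = J, constraint = chance\<rparr>)))"
proof -
  have wbar: "distributed M lborel wbar (\<lambda>v. ennreal (mvnormal_density 0 \<Sigma> v))"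
    and S: "pos_def \<Sigma>" and \<alpha>: "0 < \<alpha>" "\<alpha> < 1" and M: "prob_space M" by fact+
  interpret prob_space M by (rule M)
  have [measurable]: "wbar \<in> borel_measurable M" using distributed_measurable[OF wbar] by simp
  have \<beta>: "0 \<le> \<beta>" unfolding \<beta>_def by (rule cdf_chi_squared_beta(2)[OF \<alpha>])
  have eta: "eta Tx Tu y (x \<theta> \<omega>) (u \<theta> \<omega>) = h \<theta> + P \<theta> *v wbar \<omega>" for \<theta> \<omega>
    unfolding x_def u_def h_def P_def by (rule eta_eq_h_plus_P)
  have chance: "chance \<theta>" if inv: "invertible (\<Sigma>\<^sub>\<theta> \<theta>)" and sub: "ellip \<theta>" for \<theta>
  proof -
    have [measurable]: "(\<lambda>v. P \<theta> *v v) \<in> borel_measurable borel"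
      by (intro borel_measurable_continuous_onI linear_continuous_on) simp
    have "1 - \<alpha> = prob {\<omega> \<in> space M. h \<theta> + P \<theta> *v wbar \<omega> \<in> ellipsoid (h \<theta>) (\<Sigma>\<^sub>\<theta> \<theta>) \<beta>}"
      unfolding \<Sigma>\<^sub>\<theta>_def \<beta>_def
      by (rule prob_gaussian_in_ellipsoid[OF M wbar S _ \<alpha>, symmetric]) (use inv in \<open>simp add: \<Sigma>\<^sub>\<theta>_def\<close>)
    also have "\<dots> \<le> prob {\<omega> \<in> space M. \<forall>i. (h \<theta> + P \<theta> *v wbar \<omega>) $ i \<le> 0}"
      using sub unfolding ellip_def by (intro finite_measure_mono) auto
    finally show ?thesis by (simp add: chance_def eta)
  qed
  have ellip_iff: "ellip \<theta> \<longleftrightarrow> soc R \<theta>" if inv: "invertible (\<Sigma>\<^sub>\<theta> \<theta>)" and R: "sym_sqrt_of R \<Sigma>" for \<theta> R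
    unfolding ellip_def soc_def \<Sigma>\<^sub>\<theta>_def
    by (rule ellipsoid_subset_orthant_iff[OF S _ R \<beta>]) (use inv in \<open>simp add: \<Sigma>\<^sub>\<theta>_def\<close>)
  show ?thesis
  proof (intro conjI ballI impI allI)
    fix V :: "(real^('t option \<times> 'n)) \<times> (real^('t \<times> 'm)) \<Rightarrow> real" and R
    assume inv: "\<forall>\<theta>\<in>\<Theta>. invertible (\<Sigma>\<^sub>\<theta> \<theta>)" and V: "convex_on UNIV V"
      and int: "\<forall>\<theta>\<in>\<Theta>. integrable M (\<lambda>\<omega>. V (x \<theta> \<omega>, u \<theta> \<omega>))" and R: "sym_sqrt_of R \<Sigma>"
    have "convex_on \<Theta> (\<lambda>\<theta>. \<integral>\<omega>. V (x \<theta> \<omega>, u \<theta> \<omega>) \<partial>M)"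
      using int unfolding \<Theta>_def x_def u_def by (intro convex_expected_cost V) simp
    moreover have "convex {\<theta> \<in> \<Theta>. soc R \<theta>}"
      unfolding \<Theta>_def soc_def h_def P_def by (rule convex_soc[OF \<beta>])
    ultimately show "let J = (\<lambda>\<theta>. \<integral>\<omega>. V (x \<theta> \<omega>, u \<theta> \<omega>) \<partial>M) in
        convex_conservative_approx
          \<lparr>param_space = \<Theta>, objective = J, constraint = soc R\<rparr>
          \<lparr>param_space = \<Theta>, objective = J, constraint = chance\<rparr>"
      using inv R chance ellip_iff by (auto simp: convex_conservative_approx_def feasible_def)
  qed (use chance ellip_iff in blast)+
qed

end
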